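(* Let $\varepsilon=\{\varepsilon_n\}_{n\ge 0}$ be a sequence of positive numbers tending to zero. Suppose that $\varepsilon$ is regular, i.e., $\{\varepsilon_n\}$ is non-increasing and $\{n\varepsilon_n\}$ is non-decreasing, and that $$\sum_{n=1}^\infty \frac{\varepsilon_n}{n}=\infty .$$ Then there exists an increasing continuous function $\omega$ on $[0,\infty)$ with $\omega(0)=0$ such that for every homeomorphism $h$ of the circle $T$ onto itself there is an $f\in H^\omega(T)$ with $f\circ h\notin A_\varepsilon(T)$.
   Context: $T=\mathbb{R}/2\pi\mathbb{Z}$ is the circle. The Fourier coefficients of an integrable function $x$ on $T$ are $\widehat{x}(k)=\frac{1}{2\pi}\int_T x(t)e^{-ikt}\,dt$, $k\in\mathbb{Z}$. For a positive sequence $\varepsilon=\{\varepsilon_n\}$ tending to zero, $$A_\varepsilon(T)=\Big\{x:\ \|x\|_{A_\varepsilon}=\sum_{k\in\mathbb{Z}}|\widehat{x}(k)|\,\varepsilon_{|k|}<\infty\Big\}.$$ For an increasing continuous function $\omega$ on $[0,\infty)$ with $\omega(0)=0$, $H^\omega(T)$ denotes the class of real-valued functions $f$ on $T$ with $\omega(\delta,f)=O(\omega(\delta))$ as $\delta\to 0^+$, where $\omega(\delta,f)=\sup_{|t_1-t_2|<\delta}|f(t_1)-f(t_2)|$. *)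

theory Defs
  imports "HOL-Analysis.Analysis"
begin

text \<open>
  The circle \<open>\<real>/2\<pi>\<int>\<close> is represented by the unit circle of the complex plane, the class of
  the real number \<open>t\<close> being the point \<open>cis t\<close>. A function on the circle is a function on
  \<^typ>\<open>complex\<close> of which only the values on the unit circle matter. All integrals and distances
  below are taken in the parameter \<open>t\<close>.
\<close>

abbreviation circle :: "complex set" where
  "circle \<equiv> sphere 0 1"

definition circle_integrable :: "(complex \<Rightarrow> complex) \<Rightarrow> bool" where
  "circle_integrable x \<longleftrightarrow> set_integrable lebesgue {0..2 * pi} (\<lambda>t. x (cis t))"

definition fourier_coeff :: "(complex \<Rightarrow> complex) \<Rightarrow> int \<Rightarrow> complex" where
  "fourier_coeff x k =
     1 / (2 * pi) * (LINT t:{0..2 * pi}|lebesgue. x (cis t) * exp (- \<i> * of_int k * of_real t))"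

definition A_space :: "(nat \<Rightarrow> real) \<Rightarrow> (complex \<Rightarrow> complex) set" where
  "A_space \<epsilon> = {x. circle_integrable x \<and>
     (\<lambda>k::int. norm (fourier_coeff x k) * \<epsilon> (nat \<bar>k\<bar>)) summable_on UNIV}"

text \<open>
  The modulus of continuity is extended-real-valued, so that it is a genuine supremum for
  unbounded functions as well.
\<close>

definition modulus_of_continuity :: "(complex \<Rightarrow> real) \<Rightarrow> real \<Rightarrow> ereal" where
  "modulus_of_continuity f \<delta> =
     (SUP (s, t) \<in> {(s::real, t::real). \<bar>s - t\<bar> < \<delta>}. ereal \<bar>f (cis s) - f (cis t)\<bar>)"

definition H_class :: "(real \<Rightarrow> real) \<Rightarrow> (complex \<Rightarrow> real) set" where
  "H_class \<omega> = {f. \<exists>C::real. \<forall>\<^sub>F \<delta> in at_right 0. modulus_of_continuity f \<delta> \<le> ereal (C * \<omega> \<delta>)}"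

definition regular_seq :: "(nat \<Rightarrow> real) \<Rightarrow> bool" where
  "regular_seq \<epsilon> \<longleftrightarrow> decseq \<epsilon> \<and> incseq (\<lambda>n. real n * \<epsilon> n)"

end

theory Submission
  imports Defs
begin

text \<open>
  Pair a function \<open>x\<close> on the circle with the sine polynomial
  \<open>D\<^sub>n(u) = \<Sum>k=1..n. \<epsilon> k * sin (k u)\<close>, translated to any centre \<open>\<tau>\<close>. The result is at most \<open>2\<pi>\<close>
  times the norm of \<open>x\<close> in the weighted space (\<open>kernel_integral_le_A_norm\<close>), so a function with
  unbounded pairings lies outside the space. A primitive of \<open>D\<^sub>n\<close> is \<open>-G\<^sub>n\<close>, where
  \<open>G\<^sub>n(u) = \<Sum>k=1..n. \<epsilon> k / k * cos (k u)\<close>. Close to \<open>0\<close>, for \<open>\<bar>u\<bar> \<le> 1/n\<close>, this is at least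
  half of the divergent sum \<open>S\<^sub>n = \<Sum>k=1..n. \<epsilon> k / k\<close>, but it stays bounded for \<open>u\<close> away from
  \<open>0\<close>, since \<open>\<epsilon>\<close> is non-increasing (\<open>cosine_sum_lower\<close>, \<open>cosine_sum_upper\<close>). Hence, if \<open>x\<close> rises
  monotonically from \<open>0\<close> to \<open>1\<close> on an interval of length \<open>1/n\<close> at \<open>\<tau>\<close> and falls back to \<open>0\<close>
  monotonically far from \<open>\<tau>\<close>, the pairing is at least \<open>S\<^sub>n / 2\<close> minus a constant
  (\<open>trapezoid_integral\<close>).

  For a given homeomorphism \<open>h\<close> such an \<open>x\<close> can be found in the form \<open>F \<circ> h\<close>, where the slope of
  \<open>F\<close> is at most \<open>C n\<close> with \<open>C\<close> depending only on \<open>h\<close>. Indeed \<open>h\<close> is monotone in terms of angles, and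
  among \<open>n\<close> equal pieces of a fixed arc there is one that \<open>h\<close> does not shorten by more than the
  factor by which it shortens the arc (\<open>exists_steep_probe\<close>). As \<open>C\<close> is the only
  trace of \<open>h\<close> in the size of \<open>F\<close> and of the pairing, all constructions below that concern sizes
  are made before \<open>h\<close> is chosen.

  Take slopes \<open>m\<^sub>i\<close> increasing so fast that amplitudes \<open>a\<^sub>i\<close> exist with \<open>a\<^sub>i S\<^sub>n \<ge> i\<close> for \<open>n = m\<^sub>i\<close>
  and \<open>\<Sum>i>j. a\<^sub>i \<le> 1 / m\<^sub>j\<close> (\<open>exists_scales\<close>), and let \<open>\<omega>\<close> be a smoothed form of
  \<open>\<Sum>i. a\<^sub>i * min 1 (m\<^sub>i \<delta>)\<close>. For given \<open>h\<close> put \<open>f = \<Sum>i. s\<^sub>i a\<^sub>i F\<^sub>i\<close> with signs \<open>s\<^sub>i\<close> and \<open>F\<^sub>i\<close>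
  as above for \<open>n = m\<^sub>i\<close>. Then \<open>f\<close> belongs to the class of \<open>\<omega>\<close>
  (\<open>signed_series_in_H_class\<close>). In the \<open>j\<close>-th pairing of \<open>f \<circ> h\<close> the later terms contribute a
  bounded amount, because the kernel is at most \<open>m\<^sub>j * \<epsilon> 0\<close>; the signs are chosen one after the other so
  that the earlier terms do not cancel the \<open>j\<close>-th one (\<open>exists_signs\<close>). So the \<open>j\<close>-th pairing is
  at least \<open>j / 2\<close> minus a constant, and \<open>f \<circ> h\<close> is not in the space.
\<close>

section \<open>Sine polynomials with monotone coefficients\<close>

definition sine_kernel :: "(nat \<Rightarrow> real) \<Rightarrow> nat \<Rightarrow> real \<Rightarrow> real" where
  "sine_kernel \<epsilon> n u = (\<Sum>k=1..n. \<epsilon> k * sin (real k * u))"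

text \<open>
  The negative of a primitive of \<open>sine_kernel\<close>.
\<close>
definition cosine_sum :: "(nat \<Rightarrow> real) \<Rightarrow> nat \<Rightarrow> real \<Rightarrow> real" where
  "cosine_sum \<epsilon> n u = (\<Sum>k=1..n. \<epsilon> k / real k * cos (real k * u))"

text \<open>
  Within distance \<open>1/n\<close> of the origin all the cosines are still at least \<open>cos 1 > 1/2\<close>, so
  the whole divergent sum survives.
\<close>
lemma cosine_sum_lower:
  assumes "\<And>k. \<epsilon> k \<ge> 0" "\<bar>u\<bar> \<le> 1 / real n"
  shows "(\<Sum>k=1..n. \<epsilon> k / real k) / 2 \<le> cosine_sum \<epsilon> n u"
  unfolding cosine_sum_def sum_divide_distrib
proof (rule sum_mono)
  fix k assume k: "k \<in> {1..n}"
  have "\<bar>real k * u\<bar> \<le> real n * (1 / real n)"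
    unfolding abs_mult using k assms(2) by (intro mult_mono) auto
  also have "\<dots> \<le> pi / 3" using k pi_gt3 by simp
  finally have "cos (pi / 3) \<le> cos \<bar>real k * u\<bar>"
    using pi_gt3 by (intro cos_monotone_0_pi_le) auto
  hence "1 / 2 \<le> cos (real k * u)" by (simp add: cos_60 del: abs_mult)
  from mult_left_mono[OF this, of "\<epsilon> k / real k"] assms(1)[of k]
  show "\<epsilon> k / real k / 2 \<le> \<epsilon> k / real k * cos (real k * u)" by simp
qed

lemma abel_partial_sum_bound:
  fixes b v :: "nat \<Rightarrow> real"
  assumes dec: "\<And>k. 1 \<le> k \<Longrightarrow> b (Suc k) \<le> b k" and pos: "\<And>k. b k \<ge> 0"
    and v: "\<And>k. \<bar>v k\<bar> \<le> 1"
  shows "\<bar>\<Sum>k=1..n. b k * (v k - v (k - 1))\<bar> \<le> 2 * b 1"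
proof (cases "n = 0")
  case False
  have "\<bar>(\<Sum>k=1..n. b k * (v k - v (k - 1))) - b n * v n\<bar> \<le> 2 * b 1 - b n"
    if "1 \<le> n" for n
    using that
  proof (induction n rule: dec_induct)
    case base
    have "\<bar>b 1 * v 0\<bar> \<le> b 1 * 1"
      unfolding abs_mult using pos[of 1] v[of 0] by (intro mult_mono) auto
    then show ?case by (simp add: algebra_simps)
  next
    case (step n)
    have "\<bar>(b n - b (Suc n)) * v n\<bar> \<le> (b n - b (Suc n)) * 1"
      unfolding abs_mult using dec[of n] step v[of n] by (intro mult_mono) auto
    with step.IH step.hyps show ?case by (simp add: algebra_simps)
  qed
  from this[of n] False have "\<bar>(\<Sum>k=1..n. b k * (v k - v (k - 1))) - b n * v n\<bar> \<le> 2 * b 1 - b n"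
    by simp
  moreover have "\<bar>b n * v n\<bar> \<le> b n * 1"
    unfolding abs_mult using pos[of n] v[of n] by (intro mult_mono) auto
  ultimately show ?thesis by linarith
qed (use pos in simp)

text \<open>
  Away from the origin the cosines cancel, and summation by parts against the monotone
  coefficients \<open>\<epsilon> k / k\<close> gives a bound that is uniform in \<open>n\<close>. This and the previous
  estimate are what makes the kernel react to one steep rise and ignore a distant fall.
\<close>
lemma cosine_sum_upper:
  assumes "decseq \<epsilon>" "\<And>k. \<epsilon> k \<ge> 0" "1 \<le> u" "u \<le> 3"
  shows "cosine_sum \<epsilon> n u \<le> \<epsilon> 1 / sin (1/2)"
proof -
  define b where "b = (\<lambda>k::nat. \<epsilon> k / real k)"
  define v where "v = (\<lambda>k::nat. sin ((real k + 1/2) * u))"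
  have s0: "sin (1/2) > (0::real)" using pi_gt3 by (intro sin_gt_zero) auto
  have s: "sin (1/2) \<le> sin (u/2)"
    using assms pi_gt3 by (intro sin_monotone_2pi_le) auto
  \<comment> \<open>Multiplication by \<open>2 sin (u/2)\<close> turns each cosine into a difference of consecutive sines.\<close>
  have eq: "2 * sin (u/2) * cosine_sum \<epsilon> n u = (\<Sum>k=1..n. b k * (v k - v (k - 1)))"
    unfolding cosine_sum_def sum_distrib_left
  proof (rule sum.cong[OF refl])
    fix k assume k: "k \<in> {1..n}"
    have "v k - v (k - 1) = sin (real k * u + u/2) - sin (real k * u - u/2)"
      using k by (simp add: v_def of_nat_diff algebra_simps)
    also have "\<dots> = 2 * sin (u/2) * cos (real k * u)"
      by (simp add: sin_add sin_diff)
    finally show "2 * sin (u/2) * (\<epsilon> k / real k * cos (real k * u)) = b k * (v k - v (k - 1))"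
      by (simp add: b_def)
  qed
  have "\<bar>\<Sum>k=1..n. b k * (v k - v (k - 1))\<bar> \<le> 2 * b 1"
  proof (rule abel_partial_sum_bound)
    show "b (Suc k) \<le> b k" if "1 \<le> k" for k
      unfolding b_def using assms that by (intro frac_le) (auto simp: decseq_SucD)
  qed (use assms in \<open>auto simp: b_def v_def\<close>)
  hence "2 * sin (u/2) * cosine_sum \<epsilon> n u \<le> 2 * \<epsilon> 1" unfolding eq b_def by simp
  hence "cosine_sum \<epsilon> n u \<le> \<epsilon> 1 / sin (u/2)"
    using s s0 by (simp add: field_simps)
  also have "\<dots> \<le> \<epsilon> 1 / sin (1/2)"
    using s s0 assms(2)[of 1] by (intro divide_left_mono) auto
  finally show ?thesis .
qed

lemma integral_sine_kernel:
  assumes "c \<le> d"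
  shows "(sine_kernel \<epsilon> n has_integral (cosine_sum \<epsilon> n c - cosine_sum \<epsilon> n d)) {c..d}"
proof -
  have "(sine_kernel \<epsilon> n has_integral (- cosine_sum \<epsilon> n d - (- cosine_sum \<epsilon> n c))) {c..d}"
  proof (rule fundamental_theorem_of_calculus[OF assms])
    fix x
    have "((\<lambda>u. - cosine_sum \<epsilon> n u) has_real_derivative
            - (\<Sum>k=1..n. \<epsilon> k / real k * - (sin (real k * x) * real k))) (at x within {c..d})"
      unfolding cosine_sum_def by (auto intro!: derivative_eq_intros sum.cong)
    also have "- (\<Sum>k=1..n. \<epsilon> k / real k * - (sin (real k * x) * real k)) = sine_kernel \<epsilon> n x"
      unfolding sine_kernel_def sum_negf[symmetric] by (rule sum.cong) auto
    finally show "((\<lambda>u. - cosine_sum \<epsilon> n u) has_vector_derivative sine_kernel \<epsilon> n x)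
                    (at x within {c..d})"
      by (simp add: has_real_derivative_iff_has_vector_derivative)
  qed
  thus ?thesis by simp
qed

lemma integral_sine_kernel_shift:
  assumes "c \<le> d"
  shows "((\<lambda>t. sine_kernel \<epsilon> n (t - \<tau>)) has_integral
           (cosine_sum \<epsilon> n (c - \<tau>) - cosine_sum \<epsilon> n (d - \<tau>))) {c..d}"
  using has_integral_affinity'[OF integral_sine_kernel[of "c - \<tau>" "d - \<tau>" \<epsilon> n, folded box_real(2)], of 1 "-\<tau>"] assms
  by simp

lemma abs_sine_kernel_le:
  assumes "decseq \<epsilon>" "\<And>k. \<epsilon> k \<ge> 0"
  shows "\<bar>sine_kernel \<epsilon> n u\<bar> \<le> real n * \<epsilon> 0"
proof -
  have "\<bar>sine_kernel \<epsilon> n u\<bar> \<le> (\<Sum>k=1..n. \<bar>\<epsilon> k * sin (real k * u)\<bar>)"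
    unfolding sine_kernel_def by (rule sum_abs)
  also have "\<dots> \<le> (\<Sum>k=1..n. \<epsilon> 0 * 1)"
    unfolding abs_mult using assms by (intro sum_mono mult_mono) (auto simp: decseq_def)
  finally show ?thesis by simp
qed

lemma continuous_on_sine_kernel [continuous_intros]:
  fixes f :: "real \<Rightarrow> real"
  shows "continuous_on S f \<Longrightarrow> continuous_on S (\<lambda>t. sine_kernel \<epsilon> n (f t))"
  unfolding sine_kernel_def by (intro continuous_intros) auto

section \<open>Lower bounds for the weighted Fourier norm\<close>

text \<open>
  This replaces the integration by parts \<open>\<integral> x D = \<integral> G dx\<close>, \<open>G' = -D\<close>, for functions that
  need be neither differentiable nor absolutely continuous, such as the composition of a
  trapezoid with a homeomorphism. The second mean value theorem on the rising and on the
  falling part yields the two points; all other contributions telescope.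
\<close>
lemma trapezoid_integral:
  fixes x D G :: "real \<Rightarrow> real"
  assumes x: "continuous_on {l..r} x" and D: "continuous_on {l..r} D"
    and G: "\<And>c d. \<lbrakk>l \<le> c; c \<le> d; d \<le> r\<rbrakk> \<Longrightarrow> (D has_integral G c - G d) {c..d}"
    and ord: "l \<le> a" "a \<le> b" "b \<le> p" "p \<le> q" "q \<le> r"
    and up: "mono_on {a..b} x" and down: "antimono_on {p..q} x"
    and left: "\<And>t. t \<in> {l..a} \<Longrightarrow> x t = 0" and right: "\<And>t. t \<in> {q..r} \<Longrightarrow> x t = 0"
    and mid: "\<And>t. t \<in> {b..p} \<Longrightarrow> x t = 1"
  obtains c d where "c \<in> {a..b}" "d \<in> {p..q}" "integral {l..r} (\<lambda>t. x t * D t) = G c - G d"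
proof -
  let ?f = "\<lambda>t. x t * D t"
  have int: "?f integrable_on {u..v}" if "l \<le> u" "v \<le> r" for u v
    by (rule integrable_continuous_real, rule continuous_on_subset[of "{l..r}"])
       (use that x D in \<open>auto intro!: continuous_intros\<close>)
  have Dint: "D integrable_on {u..v}" if "l \<le> u" "v \<le> r" for u v
    by (rule integrable_continuous_real, rule continuous_on_subset[OF D]) (use that in auto)
  have I: "integral {u..v} D = G u - G v" if "l \<le> u" "u \<le> v" "v \<le> r" for u v
    using G[OF that] by (rule integral_unique)
  have zero: "integral {u..v} ?f = 0" if "\<And>t. t \<in> {u..v} \<Longrightarrow> x t = 0" for u v
  proof -
    have "integral {u..v} ?f = integral {u..v} (\<lambda>_. 0)"
      by (intro Henstock_Kurzweil_Integration.integral_cong) (use that in auto)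
    thus ?thesis by simp
  qed
  obtain c where c: "c \<in> {a..b}"
    "integral {a..b} ?f = x a * integral {a..c} D + x b * integral {c..b} D"
  proof (rule second_mean_value_theorem[of D a b x])
    show "D integrable_on {a..b}" using ord by (intro Dint) auto
    show "x u \<le> x v" if "a \<le> u" "u \<le> v" "v \<le> b" for u v
      using up that by (auto simp: monotone_on_def)
  qed (use ord in auto)
  obtain d where d: "d \<in> {p..q}"
    "integral {p..q} (\<lambda>t. - x t * D t) = - x p * integral {p..d} D + - x q * integral {d..q} D"
  proof (rule second_mean_value_theorem[of D p q "\<lambda>t. - x t"])
    show "D integrable_on {p..q}" using ord by (intro Dint) auto
    show "- x u \<le> - x v" if "p \<le> u" "u \<le> v" "v \<le> q" for u v
      using down that by (auto simp: monotone_on_def)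
  qed (use ord in auto)
  have "integral {b..p} ?f = integral {b..p} D"
    by (intro Henstock_Kurzweil_Integration.integral_cong) (use mid in auto)
  hence mp: "integral {b..p} ?f = G b - G p" using ord by (simp add: I)
  have ends: "x a = 0" "x b = 1" "x p = 1" "x q = 0"
    using left[of a] right[of q] mid[of b] mid[of p] ord by auto
  have "integral {a..b} ?f = G c - G b" using c ends ord by (simp add: I)
  moreover have "integral {p..q} ?f = G p - G d"
  proof -
    have "integral {p..d} D = G p - G d" using d(1) ord by (simp add: I)
    thus ?thesis using d(2) ends by simp
  qed
  moreover have "integral {l..r} ?f = integral {l..a} ?f + integral {a..b} ?f + integral {b..p} ?f
      + integral {p..q} ?f + integral {q..r} ?f"
    using ord by (simp add: Henstock_Kurzweil_Integration.integral_combine int)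
  ultimately have "integral {l..r} ?f = G c - G d"
    using mp zero[OF left] zero[OF right] by simp
  with c(1) d(1) show ?thesis by (rule that)
qed

lemma sine_integral_le_fourier_coeff:
  fixes X :: "complex \<Rightarrow> real"
  assumes X: "continuous_on {0..2*pi} (\<lambda>t. X (cis t))"
  shows "\<bar>integral {0..2*pi} (\<lambda>t. X (cis t) * sin (real k * (t - \<tau>)))\<bar>
           \<le> 2 * pi * norm (fourier_coeff (\<lambda>z. complex_of_real (X z)) (int k))"
proof -
  let ?e = "\<lambda>t. complex_of_real (X (cis t)) * exp (- \<i> * of_int (int k) * of_real t)"
  have ec: "continuous_on {0..2*pi} ?e" by (intro continuous_intros X)
  have "(LINT t:{0..2*pi}|lebesgue. ?e t) = integral {0..2*pi} ?e"
    by (rule set_lebesgue_integral_eq_integral)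
       (use absolutely_integrable_continuous_real[OF ec] in simp)
  hence fc: "integral {0..2*pi} ?e = 2 * pi * fourier_coeff (\<lambda>z. complex_of_real (X z)) (int k)"
    unfolding fourier_coeff_def by simp
  have "integral {0..2*pi} (\<lambda>t. X (cis t) * sin (real k * (t - \<tau>)))
      = integral {0..2*pi} ((\<lambda>z. - Im (cis (real k * \<tau>) * z)) \<circ> ?e)"
  proof (rule Henstock_Kurzweil_Integration.integral_cong)
    fix t
    have "cis (real k * \<tau>) * ?e t = of_real (X (cis t)) * cis (real k * \<tau> - real k * t)"
      by (simp add: cis_conv_exp exp_add[symmetric] exp_diff algebra_simps exp_minus field_simps)
    hence "Im (cis (real k * \<tau>) * ?e t) = X (cis t) * sin (real k * \<tau> - real k * t)"
      by (simp only: Im_complex_of_real Re_complex_of_real times_complex.sel cis.sel)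
    thus "X (cis t) * sin (real k * (t - \<tau>)) = ((\<lambda>z. - Im (cis (real k * \<tau>) * z)) \<circ> ?e) t"
      by (simp add: sin_diff algebra_simps del: times_complex.sel)
  qed
  also have "\<dots> = - Im (cis (real k * \<tau>) * integral {0..2*pi} ?e)"
    by (intro integral_linear integrable_continuous_real[OF ec] bounded_linear_minus
          bounded_linear_compose[OF bounded_linear_Im] bounded_linear_mult_right)
  finally have "\<bar>integral {0..2*pi} (\<lambda>t. X (cis t) * sin (real k * (t - \<tau>)))\<bar>
      \<le> cmod (cis (real k * \<tau>) * integral {0..2*pi} ?e)"
    by (simp only: abs_minus_cancel abs_Im_le_cmod)
  also have "\<dots> = 2 * pi * norm (fourier_coeff (\<lambda>z. complex_of_real (X z)) (int k))"
    unfolding fc by (simp add: norm_mult)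
  finally show ?thesis .
qed

text \<open>
  Pairing with \<open>sine_kernel \<epsilon> n (t - \<tau>)\<close> is dominated by the weighted norm
  whatever \<open>n\<close> and \<open>\<tau>\<close> are; membership in the space is refuted by exhibiting
  unbounded pairings.
\<close>
lemma kernel_integral_le_A_norm:
  fixes X :: "complex \<Rightarrow> real"
  assumes X: "continuous_on {0..2*pi} (\<lambda>t. X (cis t))"
    and A: "(\<lambda>z. complex_of_real (X z)) \<in> A_space \<epsilon>" and pos: "\<And>k. \<epsilon> k \<ge> 0"
  shows "\<bar>integral {0..2*pi} (\<lambda>t. X (cis t) * sine_kernel \<epsilon> n (t - \<tau>))\<bar>
     \<le> 2 * pi * (\<Sum>\<^sub>\<infinity>k::int. norm (fourier_coeff (\<lambda>z. complex_of_real (X z)) k) * \<epsilon> (nat \<bar>k\<bar>))"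
proof -
  let ?w = "\<lambda>k::int. norm (fourier_coeff (\<lambda>z. complex_of_real (X z)) k) * \<epsilon> (nat \<bar>k\<bar>)"
  have "integral {0..2*pi} (\<lambda>t. X (cis t) * sine_kernel \<epsilon> n (t - \<tau>))
     = integral {0..2*pi} (\<lambda>t. \<Sum>k=1..n. \<epsilon> k * (X (cis t) * sin (real k * (t - \<tau>))))"
    unfolding sine_kernel_def sum_distrib_left
    by (intro Henstock_Kurzweil_Integration.integral_cong sum.cong) auto
  also have "\<dots> = (\<Sum>k=1..n. \<epsilon> k * integral {0..2*pi} (\<lambda>t. X (cis t) * sin (real k * (t - \<tau>))))"
    by (subst integral_sum) (auto intro!: integrable_continuous_real continuous_intros X)
  also have "\<bar>\<dots>\<bar> \<le> (\<Sum>k=1..n. \<epsilon> k * (2 * pi * norm (fourier_coeff (\<lambda>z. complex_of_real (X z)) (int k))))"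
    by (rule order.trans[OF sum_abs], unfold abs_mult, intro sum_mono mult_mono
          sine_integral_le_fourier_coeff X) (use pos in auto)
  also have "\<dots> = 2 * pi * (\<Sum>k=1..n. ?w (int k))"
    by (simp add: sum_distrib_left algebra_simps)
  also have "(\<Sum>k=1..n. ?w (int k)) = sum ?w (int ` {1..n})"
    by (subst sum.reindex) (auto simp: o_def)
  also have "\<dots> \<le> infsum ?w UNIV"
    by (rule finite_sum_le_infsum) (use A pos in \<open>auto simp: A_space_def\<close>)
  finally show ?thesis by simp
qed

section \<open>Circle homeomorphisms in angular coordinates\<close>

lemma Arg2pi_cis: "Arg2pi (cis s) = s - 2 * pi * of_int \<lfloor>s / (2 * pi)\<rfloor>"
proof (rule Arg2pi_unique[of 1])
  have pi2: "2 * pi > 0" by simp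
  have "exp (\<i> * complex_of_real (s - 2 * pi * of_int \<lfloor>s / (2 * pi)\<rfloor>))
      = cis (s - 2 * pi * of_int \<lfloor>s / (2 * pi)\<rfloor>)"
    by (simp add: cis_conv_exp)
  also have "\<dots> = cis s"
    unfolding cis_divide[symmetric] by (simp add: cis_multiple_2pi)
  finally show "complex_of_real 1 * exp (\<i> * complex_of_real (s - 2 * pi * of_int \<lfloor>s / (2 * pi)\<rfloor>)) = cis s"
    by simp
  have "of_int \<lfloor>s / (2 * pi)\<rfloor> \<le> s / (2 * pi)" "s / (2 * pi) < of_int \<lfloor>s / (2 * pi)\<rfloor> + 1"
    by linarith+
  thus "0 \<le> s - 2 * pi * of_int \<lfloor>s / (2 * pi)\<rfloor>" "s - 2 * pi * of_int \<lfloor>s / (2 * pi)\<rfloor> < 2 * pi"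
    unfolding pos_le_divide_eq[OF pi2] pos_divide_less_eq[OF pi2] by (simp_all add: algebra_simps)
qed simp

text \<open>
  The angle itself jumps at the base point \<open>p\<close>; a function of the angle that takes equal values at
  both ends of \<open>[0, 2\<pi>]\<close> does not notice this and keeps its Lipschitz constant in
  the parameter of the circle.
\<close>
lemma lipschitz_Arg2pi:
  fixes \<psi> :: "real \<Rightarrow> real"
  assumes lip: "\<And>x y. \<bar>\<psi> x - \<psi> y\<bar> \<le> L * \<bar>x - y\<bar>" and per: "\<psi> 0 = \<psi> (2 * pi)"
    and p: "norm p = 1"
  shows "\<bar>\<psi> (Arg2pi (cis s / p)) - \<psi> (Arg2pi (cis t / p))\<bar> \<le> L * \<bar>s - t\<bar>"
proof -
  obtain \<theta> where \<theta>: "p = cis \<theta>"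
  proof -
    have "cis (Arg p) = p" using p by (subst cis_Arg) (auto simp: sgn_div_norm)
    thus ?thesis using that by metis
  qed
  have L: "L \<ge> 0" using lip[of 0 1] by simp
  have *: "\<bar>\<psi> (Arg2pi (cis s)) - \<psi> (Arg2pi (cis t))\<bar> \<le> L * (t - s)" if "s \<le> t" for s t
  proof -
    define i j where "i = \<lfloor>s / (2 * pi)\<rfloor>" and "j = \<lfloor>t / (2 * pi)\<rfloor>"
    define x y where "x = s - 2 * pi * of_int i" and "y = t - 2 * pi * of_int j"
    have xy: "Arg2pi (cis s) = x" "Arg2pi (cis t) = y"
      by (simp_all add: Arg2pi_cis x_def y_def i_def j_def)
    have bx: "0 \<le> x" "x < 2 * pi" and by': "0 \<le> y" "y < 2 * pi"
      using Arg2pi[of "cis s"] Arg2pi[of "cis t"] xy by auto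
    have "i \<le> j" unfolding i_def j_def using that by (intro floor_mono divide_right_mono) auto
    then consider "j = i" | "j = i + 1" | "i + 2 \<le> j" by linarith
    hence "\<bar>\<psi> x - \<psi> y\<bar> \<le> L * (t - s)"
    proof cases
      case 1
      then show ?thesis using lip[of x y] that by (simp add: x_def y_def)
    next
      case 2
      \<comment> \<open>The arc from \<open>s\<close> to \<open>t\<close> passes the base point, where \<open>\<psi>\<close> closes up.\<close>
      have "\<bar>\<psi> x - \<psi> y\<bar> \<le> \<bar>\<psi> x - \<psi> (2 * pi)\<bar> + \<bar>\<psi> 0 - \<psi> y\<bar>" using per by linarith
      also have "\<dots> \<le> L * \<bar>x - 2 * pi\<bar> + L * \<bar>0 - y\<bar>" by (intro add_mono lip)
      also have "\<dots> = L * (2 * pi - x + y)" using bx by' by (simp add: algebra_simps)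
      also have "2 * pi - x + y = t - s" using 2 by (simp add: x_def y_def algebra_simps)
      finally show ?thesis .
    next
      case 3
      hence "real_of_int i + 2 \<le> real_of_int j" by linarith
      hence "2 * pi * (real_of_int i + 2) \<le> 2 * pi * real_of_int j"
        by (intro mult_left_mono) auto
      hence "\<bar>x - y\<bar> \<le> t - s" using bx by' by (simp add: x_def y_def algebra_simps)
      with lip[of x y] L show ?thesis by (meson mult_left_mono order_trans)
    qed
    thus ?thesis by (simp add: xy)
  qed
  have "\<bar>\<psi> (Arg2pi (cis (s - \<theta>))) - \<psi> (Arg2pi (cis (t - \<theta>)))\<bar> \<le> L * \<bar>s - t\<bar>"
    using *[of "s - \<theta>" "t - \<theta>"] *[of "t - \<theta>" "s - \<theta>"]
    by (cases "s \<le> t") (auto simp: abs_minus_commute)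
  thus ?thesis by (simp add: \<theta> cis_divide)
qed

text \<open>
  In place of a lift to the line it is enough to cut the circle at \<open>1\<close> and its image at \<open>h 1\<close>.
  The angle \<open>A\<close> of \<open>h (cis t)\<close> from \<open>h 1\<close> is then continuous and injective on
  \<open>(0, 2\<pi>)\<close>, hence monotone; if \<open>h\<close> reverses the orientation, angles are counted
  clockwise. The coordinate \<open>\<Theta>\<close> depends on the image point alone, which allows functions on the
  image circle to be prescribed through it.
\<close>
lemma circle_homeomorphism_angle:
  assumes "homeomorphism circle circle h g"
  obtains A \<Theta> :: "_ \<Rightarrow> real" where
    "continuous_on {0<..<2*pi} A" "strict_mono_on {0<..<2*pi} A"
    "\<And>t. t \<in> {0<..<2*pi} \<Longrightarrow> A t \<in> {0<..<2*pi}"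
    "\<And>t. t \<in> {0<..<2*pi} \<Longrightarrow> \<Theta> (h (cis t)) = A t"
    "\<Theta> (h 1) \<in> {0, 2*pi}"
    "\<forall>(\<psi>::real\<Rightarrow>real) L s t. (\<forall>x y. \<bar>\<psi> x - \<psi> y\<bar> \<le> L * \<bar>x - y\<bar>) \<longrightarrow> \<psi> 0 = \<psi> (2*pi) \<longrightarrow>
       \<bar>\<psi> (\<Theta> (cis s)) - \<psi> (\<Theta> (cis t))\<bar> \<le> L * \<bar>s - t\<bar>"
proof -
  let ?I = "{0<..<2*pi}"
  define p where "p = h 1"
  define B where "B = (\<lambda>t. Arg2pi (h (cis t) / p))"
  have hc: "continuous_on circle h" and hin: "\<And>z. z \<in> circle \<Longrightarrow> h z \<in> circle"
    and inj: "inj_on h circle"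
  proof -
    show "continuous_on circle h" using assms by (simp add: homeomorphism_def)
    show "h z \<in> circle" if "z \<in> circle" for z
      using assms that unfolding homeomorphism_def by blast
    show "inj_on h circle"
      using assms unfolding homeomorphism_def by (metis inj_on_def)
  qed
  have p: "norm p = 1" "p \<noteq> 0" using hin[of 1] by (auto simp: p_def)
  have nrm: "norm (h (cis t) / p) = 1" for t
    using hin[of "cis t"] p by (simp add: norm_divide)
  have exp_Arg: "h (cis t) / p = exp (\<i> * Arg2pi (h (cis t) / p))" for t
    using nrm[of t] by (metis complex_norm_eq_1_exp)
  have cis1: "cis t = 1 \<longleftrightarrow> t = 0" if "0 \<le> t" "t < 2*pi" for t
    using that Arg2pi_unique[of 1 t "1"] Arg2pi_unique[of 1 0 "1"] by (auto simp: cis_conv_exp)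
  have nonneg: "h (cis t) / p \<notin> \<real>\<^sub>\<ge>\<^sub>0" if "t \<in> ?I" for t
  proof
    assume "h (cis t) / p \<in> \<real>\<^sub>\<ge>\<^sub>0"
    then obtain r where r: "h (cis t) / p = of_real r" "r \<ge> 0"
      by (auto elim: nonneg_Reals_cases)
    with nrm[of t] have "h (cis t) / p = 1" by simp
    hence "h (cis t) = h 1" using p by (simp add: p_def)
    hence "cis t = 1" using inj by (auto dest: inj_onD)
    thus False using that cis1[of t] by auto
  qed
  have contB: "continuous_on ?I B"
    unfolding B_def
  proof (rule continuous_on_compose2[of "- \<real>\<^sub>\<ge>\<^sub>0" Arg2pi])
    show "continuous_on (- \<real>\<^sub>\<ge>\<^sub>0) Arg2pi"
      by (auto intro!: continuous_at_imp_continuous_on continuous_at_Arg2pi)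
    have "continuous_on ?I (\<lambda>t. h (cis t))"
      by (rule continuous_on_compose2[OF hc]) (auto intro!: continuous_intros)
    thus "continuous_on ?I (\<lambda>t. h (cis t) / p)" by (intro continuous_intros) (use p in auto)
  qed (use nonneg in auto)
  have rangeB: "B t \<in> ?I" if "t \<in> ?I" for t
  proof -
    have "B t \<noteq> 0"
      using nonneg[OF that] unfolding B_def Arg2pi_eq_0
      by (metis complex_is_Real_iff complex_nonneg_Reals_iff)
    thus ?thesis using Arg2pi[of "h (cis t) / p"] by (auto simp: B_def)
  qed
  have "inj_on B ?I"
  proof (rule inj_onI)
    fix s t assume st: "s \<in> ?I" "t \<in> ?I" "B s = B t"
    hence "h (cis s) / p = h (cis t) / p"
      unfolding B_def by (metis exp_Arg)
    hence "cis s = cis t" using p inj by (auto dest: inj_onD)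
    thus "s = t" using st Arg2pi_unique[of 1 s "cis s"] Arg2pi_unique[of 1 t "cis s"]
      by (auto simp: cis_conv_exp)
  qed
  hence "strict_mono_on ?I B \<or> strict_antimono_on ?I B"
    using contB by (subst (asm) injective_eq_monotone_map) (auto simp: is_interval_oo)
  thus ?thesis
  proof
    assume mono: "strict_mono_on ?I B"
    show ?thesis
    proof (rule that[of B "\<lambda>z. Arg2pi (z / p)"])
      have "\<bar>\<psi> (Arg2pi (cis s / p)) - \<psi> (Arg2pi (cis t / p))\<bar> \<le> L * \<bar>s - t\<bar>"
        if "\<And>x y. \<bar>\<psi> x - \<psi> y\<bar> \<le> L * \<bar>x - y\<bar>" "\<psi> 0 = \<psi> (2*pi)" for \<psi> :: "real \<Rightarrow> real" and L s t
        by (rule lipschitz_Arg2pi) (use that p in auto)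
      thus "\<forall>(\<psi>::real\<Rightarrow>real) L s t. (\<forall>x y. \<bar>\<psi> x - \<psi> y\<bar> \<le> L * \<bar>x - y\<bar>) \<longrightarrow> \<psi> 0 = \<psi> (2*pi) \<longrightarrow>
          \<bar>\<psi> (Arg2pi (cis s / p)) - \<psi> (Arg2pi (cis t / p))\<bar> \<le> L * \<bar>s - t\<bar>"
        by blast
    qed (use contB mono rangeB p in \<open>auto simp: B_def p_def Arg2pi_of_real[of 1, simplified]\<close>)
  next
    assume anti: "strict_antimono_on ?I B"
    show ?thesis
    proof (rule that[of "\<lambda>t. 2 * pi - B t" "\<lambda>z. 2 * pi - Arg2pi (z / p)"])
      show "continuous_on ?I (\<lambda>t. 2 * pi - B t)" by (intro continuous_intros contB)
      show "strict_mono_on ?I (\<lambda>t. 2 * pi - B t)" using anti by (auto simp: monotone_on_def)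
      have "\<bar>\<psi> (2 * pi - Arg2pi (cis s / p)) - \<psi> (2 * pi - Arg2pi (cis t / p))\<bar> \<le> L * \<bar>s - t\<bar>"
        if "\<And>x y. \<bar>\<psi> x - \<psi> y\<bar> \<le> L * \<bar>x - y\<bar>" "\<psi> 0 = \<psi> (2*pi)" for \<psi> :: "real \<Rightarrow> real" and L s t
      proof (rule lipschitz_Arg2pi[where \<psi> = "\<lambda>x. \<psi> (2 * pi - x)"])
        show "\<bar>\<psi> (2 * pi - x) - \<psi> (2 * pi - y)\<bar> \<le> L * \<bar>x - y\<bar>" for x y
          using that(1)[of "2 * pi - x" "2 * pi - y"] by (simp add: abs_minus_commute)
      qed (use that p in auto)
      thus "\<forall>(\<psi>::real\<Rightarrow>real) L s t. (\<forall>x y. \<bar>\<psi> x - \<psi> y\<bar> \<le> L * \<bar>x - y\<bar>) \<longrightarrow> \<psi> 0 = \<psi> (2*pi) \<longrightarrow>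
          \<bar>\<psi> (2 * pi - Arg2pi (cis s / p)) - \<psi> (2 * pi - Arg2pi (cis t / p))\<bar> \<le> L * \<bar>s - t\<bar>"
        by blast
    qed (use rangeB p in \<open>auto simp: B_def p_def Arg2pi_of_real[of 1, simplified]\<close>)
  qed
qed

section \<open>Steep functions adapted to a homeomorphism\<close>

lemma exists_large_increment:
  fixes u :: "nat \<Rightarrow> real"
  assumes "n \<ge> 1"
  obtains i where "i < n" "(u n - u 0) / real n \<le> u (Suc i) - u i"
proof -
  have "\<exists>i<n. (u n - u 0) / real n \<le> u (Suc i) - u i"
  proof (rule ccontr)
    assume "\<not> ?thesis"
    hence "(\<Sum>i<n. u (Suc i) - u i) < (\<Sum>i<n. (u n - u 0) / real n)"
      using assms by (intro sum_strict_mono) (auto simp: not_le lessThan_empty_iff)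
    thus False using assms by (simp add: sum_lessThan_telescope)
  qed
  thus ?thesis using that by blast
qed

definition trapezoid :: "real \<Rightarrow> real \<Rightarrow> real \<Rightarrow> real \<Rightarrow> real \<Rightarrow> real" where
  "trapezoid \<alpha> \<beta> \<gamma> \<delta> y = max 0 (min 1 (min ((y - \<alpha>) / (\<beta> - \<alpha>)) ((\<delta> - y) / (\<delta> - \<gamma>))))"

lemma trapezoid_bounds: "0 \<le> trapezoid \<alpha> \<beta> \<gamma> \<delta> y" "trapezoid \<alpha> \<beta> \<gamma> \<delta> y \<le> 1"
  by (auto simp: trapezoid_def)

lemma trapezoid_values:
  assumes "\<alpha> < \<beta>" "\<beta> \<le> \<gamma>" "\<gamma> < \<delta>"
  shows "y \<le> \<alpha> \<Longrightarrow> trapezoid \<alpha> \<beta> \<gamma> \<delta> y = 0"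
    and "\<delta> \<le> y \<Longrightarrow> trapezoid \<alpha> \<beta> \<gamma> \<delta> y = 0"
    and "\<beta> \<le> y \<Longrightarrow> y \<le> \<gamma> \<Longrightarrow> trapezoid \<alpha> \<beta> \<gamma> \<delta> y = 1"
proof -
  show "trapezoid \<alpha> \<beta> \<gamma> \<delta> y = 0" if "y \<le> \<alpha>"
  proof -
    have "(y - \<alpha>) / (\<beta> - \<alpha>) \<le> 0" using assms that by (simp add: divide_nonpos_pos)
    thus ?thesis by (simp add: trapezoid_def)
  qed
  show "trapezoid \<alpha> \<beta> \<gamma> \<delta> y = 0" if "\<delta> \<le> y"
  proof -
    have "(\<delta> - y) / (\<delta> - \<gamma>) \<le> 0" using assms that by (simp add: divide_nonpos_pos)
    thus ?thesis by (simp add: trapezoid_def)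
  qed
  show "trapezoid \<alpha> \<beta> \<gamma> \<delta> y = 1" if "\<beta> \<le> y" "y \<le> \<gamma>"
  proof -
    have "1 \<le> (y - \<alpha>) / (\<beta> - \<alpha>)" "1 \<le> (\<delta> - y) / (\<delta> - \<gamma>)"
      using assms that by (simp_all add: field_simps)
    thus ?thesis by (simp add: trapezoid_def)
  qed
qed

lemma trapezoid_mono:
  assumes "\<alpha> < \<beta>" "\<beta> \<le> \<gamma>" "\<gamma> < \<delta>" "x \<le> y" "y \<le> \<gamma>"
  shows "trapezoid \<alpha> \<beta> \<gamma> \<delta> x \<le> trapezoid \<alpha> \<beta> \<gamma> \<delta> y"
proof -
  have "1 \<le> (\<delta> - x) / (\<delta> - \<gamma>)" "1 \<le> (\<delta> - y) / (\<delta> - \<gamma>)"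
    using assms by (auto simp: field_simps)
  moreover have "(x - \<alpha>) / (\<beta> - \<alpha>) \<le> (y - \<alpha>) / (\<beta> - \<alpha>)"
    using assms by (intro divide_right_mono) auto
  ultimately show ?thesis unfolding trapezoid_def by linarith
qed

lemma trapezoid_antimono:
  assumes "\<alpha> < \<beta>" "\<beta> \<le> \<gamma>" "\<gamma> < \<delta>" "x \<le> y" "\<beta> \<le> x"
  shows "trapezoid \<alpha> \<beta> \<gamma> \<delta> y \<le> trapezoid \<alpha> \<beta> \<gamma> \<delta> x"
proof -
  have "1 \<le> (x - \<alpha>) / (\<beta> - \<alpha>)" "1 \<le> (y - \<alpha>) / (\<beta> - \<alpha>)"
    using assms by (auto simp: field_simps)
  moreover have "(\<delta> - y) / (\<delta> - \<gamma>) \<le> (\<delta> - x) / (\<delta> - \<gamma>)"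
    using assms by (intro divide_right_mono) auto
  ultimately show ?thesis unfolding trapezoid_def by linarith
qed

lemma trapezoid_lipschitz:
  assumes "\<alpha> < \<beta>" "\<gamma> < \<delta>" "1 / (\<beta> - \<alpha>) \<le> L" "1 / (\<delta> - \<gamma>) \<le> L"
  shows "\<bar>trapezoid \<alpha> \<beta> \<gamma> \<delta> x - trapezoid \<alpha> \<beta> \<gamma> \<delta> y\<bar> \<le> L * \<bar>x - y\<bar>"
proof -
  have "\<bar>(x - \<alpha>) / (\<beta> - \<alpha>) - (y - \<alpha>) / (\<beta> - \<alpha>)\<bar> = 1 / (\<beta> - \<alpha>) * \<bar>x - y\<bar>"
    using assms by (simp flip: diff_divide_distrib)
  also have "\<dots> \<le> L * \<bar>x - y\<bar>" using assms by (intro mult_right_mono) auto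
  finally have 1: "\<bar>(x - \<alpha>) / (\<beta> - \<alpha>) - (y - \<alpha>) / (\<beta> - \<alpha>)\<bar> \<le> L * \<bar>x - y\<bar>" .
  have "\<bar>(\<delta> - x) / (\<delta> - \<gamma>) - (\<delta> - y) / (\<delta> - \<gamma>)\<bar> = 1 / (\<delta> - \<gamma>) * \<bar>x - y\<bar>"
    using assms by (simp add: abs_minus_commute flip: diff_divide_distrib)
  also have "\<dots> \<le> L * \<bar>x - y\<bar>" using assms by (intro mult_right_mono) auto
  finally have 2: "\<bar>(\<delta> - x) / (\<delta> - \<gamma>) - (\<delta> - y) / (\<delta> - \<gamma>)\<bar> \<le> L * \<bar>x - y\<bar>" .
  show ?thesis unfolding trapezoid_def using 1 2 by linarith
qed

text \<open>
  The lower bound for the pairing is the gap between the values of \<open>cosine_sum\<close> within distance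
  \<open>1/n\<close> of the origin, where \<open>F \<circ> h\<close> rises, and its values on \<open>[1, 3]\<close>, where it falls. The factor \<open>C\<close> in
  the Lipschitz constant is there to be shared by all \<open>n\<close>.
\<close>
definition steep_probe ::
  "(nat \<Rightarrow> real) \<Rightarrow> (complex \<Rightarrow> complex) \<Rightarrow> real \<Rightarrow> nat \<Rightarrow> (complex \<Rightarrow> real) \<Rightarrow> real \<Rightarrow> bool" where
  "steep_probe \<epsilon> h C n F \<tau> \<longleftrightarrow>
     (\<forall>z. 0 \<le> F z \<and> F z \<le> 1) \<and>
     (\<forall>s t. \<bar>F (cis s) - F (cis t)\<bar> \<le> C * real n * \<bar>s - t\<bar>) \<and>
     continuous_on {0..2*pi} (\<lambda>t. F (h (cis t))) \<and>
     (\<Sum>k=1..n. \<epsilon> k / real k) / 2 - \<epsilon> 1 / sin (1/2)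
       \<le> integral {0..2*pi} (\<lambda>t. F (h (cis t)) * sine_kernel \<epsilon> n (t - \<tau>))"

text \<open>
  The function \<open>F\<close> climbs from \<open>0\<close> to \<open>1\<close> so that \<open>F \<circ> h\<close> does its climbing on an interval
  of length \<open>1/n\<close> inside \<open>[1, 2]\<close>, and falls back while \<open>t\<close> runs through \<open>[3, 4]\<close>. As a
  homeomorphism may squeeze intervals, the climb is placed on one of \<open>n\<close> equal pieces of
  \<open>[1, 2]\<close> whose image is no shorter than the average. That average is \<open>1/n\<close> of the length of the
  image of \<open>[1, 2]\<close>, so the slope of \<open>F\<close> is at most \<open>n\<close> times a constant that depends on \<open>h\<close> alone.
\<close>
lemma exists_steep_probe:
  assumes hom: "homeomorphism circle circle h g"
    and \<epsilon>: "decseq \<epsilon>" "\<And>k. \<epsilon> k \<ge> 0"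
  obtains C where "C \<ge> 1" "\<And>n. n \<ge> 1 \<Longrightarrow> \<exists>F \<tau>. steep_probe \<epsilon> h C n F \<tau>"
proof -
  let ?I = "{0<..<2*pi}"
  obtain A \<Theta> :: "_ \<Rightarrow> real" where A: "continuous_on ?I A" "strict_mono_on ?I A"
    and rangeA: "\<And>t. t \<in> ?I \<Longrightarrow> A t \<in> ?I"
    and \<Theta>: "\<And>t. t \<in> ?I \<Longrightarrow> \<Theta> (h (cis t)) = A t" "\<Theta> (h 1) \<in> {0, 2*pi}"
    and lip: "\<forall>(\<psi>::real\<Rightarrow>real) L s t. (\<forall>x y. \<bar>\<psi> x - \<psi> y\<bar> \<le> L * \<bar>x - y\<bar>) \<longrightarrow> \<psi> 0 = \<psi> (2*pi) \<longrightarrow>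
       \<bar>\<psi> (\<Theta> (cis s)) - \<psi> (\<Theta> (cis t))\<bar> \<le> L * \<bar>s - t\<bar>"
    by (rule circle_homeomorphism_angle[OF hom]) (rule that)
  have less: "A s < A t" if "0 < s" "s < t" "t < 2*pi" for s t
    using A(2) that by (auto simp: monotone_on_def)
  have le: "A s \<le> A t" if "0 < s" "s \<le> t" "t < 2*pi" for s t
    using less[of s t] that by (cases "s = t") auto
  define C where "C = max 1 (max (1 / (A 2 - A 1)) (1 / (A 4 - A 3)))"
  have A12: "A 1 < A 2" "A 3 < A 4" using pi_gt3 by (auto intro!: less)
  show ?thesis
  proof (rule that[of C])
    show "1 \<le> C" by (simp add: C_def)
    fix n :: nat assume n: "n \<ge> 1"
    obtain i where i: "i < n"
      "(A (1 + real n / real n) - A (1 + real 0 / real n)) / real n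
         \<le> A (1 + real (Suc i) / real n) - A (1 + real i / real n)"
      using exists_large_increment[OF n, of "\<lambda>i. A (1 + real i / real n)"] by blast
    define a b where "a = 1 + real i / real n" and "b = 1 + real (Suc i) / real n"
    have "real i < real n" "real (Suc i) \<le> real n" using i(1) by linarith+
    hence ab: "1 \<le> a" "a < b" "b \<le> 2" "b - a = 1 / real n"
      using i(1) by (auto simp: a_def b_def field_simps)
    have inc: "(A 2 - A 1) / real n \<le> A b - A a"
      using i(2) n unfolding a_def b_def by simp
    have ord: "A a < A b" "A b \<le> A 3" "A 3 < A 4"
      using ab A12 pi_gt3 by (auto intro!: less le)
    define \<psi> where "\<psi> = trapezoid (A a) (A b) (A 3) (A 4)"
    have "A a \<in> ?I" "A 4 \<in> ?I" using ab pi_gt3 by (auto intro!: rangeA[unfolded greaterThanLessThan_iff])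
    hence \<psi>0: "\<psi> 0 = 0" "\<psi> (2*pi) = 0"
      using ord by (auto simp: \<psi>_def trapezoid_values)
    have C1: "1 / (A b - A a) \<le> C * real n"
    proof -
      have "1 / (A b - A a) \<le> 1 / ((A 2 - A 1) / real n)"
        using inc A12 n by (intro divide_left_mono) (auto intro!: mult_pos_pos divide_pos_pos simp: ord)
      also have "\<dots> = 1 / (A 2 - A 1) * real n" by simp
      also have "\<dots> \<le> C * real n" by (intro mult_right_mono) (auto simp: C_def)
      finally show ?thesis .
    qed
    have C2: "1 / (A 4 - A 3) \<le> C * real n"
    proof -
      have "1 / (A 4 - A 3) \<le> C * 1" by (simp add: C_def)
      also have "\<dots> \<le> C * real n" using n by (intro mult_left_mono) (auto simp: C_def)
      finally show ?thesis .
    qed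
    have \<psi>lip: "\<bar>\<psi> x - \<psi> y\<bar> \<le> C * real n * \<bar>x - y\<bar>" for x y
      unfolding \<psi>_def using ord C1 C2 by (intro trapezoid_lipschitz) auto
    define F where "F = (\<lambda>z. \<psi> (\<Theta> z))"
    define x where "x = (\<lambda>t. F (h (cis t)))"
    have x_in: "x t = \<psi> (A t)" if "t \<in> ?I" for t using that by (simp add: x_def F_def \<Theta>)
    have x_end: "x 0 = 0" "x (2*pi) = 0" using \<Theta>(2) \<psi>0 by (auto simp: x_def F_def)
    have x_left: "x t = 0" if "t \<in> {0..a}" for t
    proof (cases "t = 0")
      case False
      hence "t \<in> ?I" "A t \<le> A a" using that ab pi_gt3 by (auto intro!: le)
      thus ?thesis using ord by (simp add: x_in \<psi>_def trapezoid_values)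
    qed (simp add: x_end)
    have x_right: "x t = 0" if "t \<in> {4..2*pi}" for t
    proof (cases "t = 2*pi")
      case False
      hence "t \<in> ?I" "A 4 \<le> A t" using that pi_gt3 by (auto intro!: le)
      thus ?thesis using ord by (simp add: x_in \<psi>_def trapezoid_values)
    qed (simp add: x_end)
    have x_mid: "x t = 1" if "t \<in> {b..3}" for t
    proof -
      have "t \<in> ?I" "A b \<le> A t" "A t \<le> A 3" using that ab pi_gt3 by (auto intro!: le)
      thus ?thesis using ord by (simp add: x_in \<psi>_def trapezoid_values)
    qed
    have x_cont: "continuous_on {0..2*pi} x"
    proof -
      have psi_cont: "continuous_on UNIV \<psi>"
        unfolding \<psi>_def trapezoid_def using ord by (intro continuous_intros) auto
      have sub: "{a..4} \<subseteq> ?I" using ab pi_gt3 by auto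
      have "continuous_on {a..4} (\<lambda>t. \<psi> (A t))"
        by (rule continuous_on_compose2[OF psi_cont continuous_on_subset[OF A(1) sub]]) auto
      hence "continuous_on {a..4} x"
        using sub by (subst continuous_on_cong[OF refl x_in]) auto
      moreover have "continuous_on {0..a} x" "continuous_on {4..2*pi} x"
        by (subst continuous_on_cong[OF refl x_left], auto)
           (subst continuous_on_cong[OF refl x_right], auto)
      ultimately have "continuous_on ({0..a} \<union> ({a..4} \<union> {4..2*pi})) x"
        by (intro continuous_on_closed_Un closed_Un) auto
      moreover have "{0..a} \<union> ({a..4} \<union> {4..2*pi}) = {0..2*pi}" using ab pi_gt3 by auto
      ultimately show ?thesis by simp
    qed
    obtain c d where cd: "c \<in> {a..b}" "d \<in> {3..4}" and
      "integral {0..2*pi} (\<lambda>t. x t * sine_kernel \<epsilon> n (t - a))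
         = cosine_sum \<epsilon> n (c - a) - cosine_sum \<epsilon> n (d - a)"
    proof (rule trapezoid_integral[where x = x and D = "\<lambda>t. sine_kernel \<epsilon> n (t - a)"
            and G = "\<lambda>t. cosine_sum \<epsilon> n (t - a)" and l = 0 and r = "2*pi"
            and a = a and b = b and p = 3 and q = 4])
      show "mono_on {a..b} x"
      proof (rule monotone_onI)
        fix s t assume st: "s \<in> {a..b}" "t \<in> {a..b}" "s \<le> t"
        hence "s \<in> ?I" "t \<in> ?I" "A s \<le> A t" "A t \<le> A 3" using ab pi_gt3 by (auto intro!: le)
        thus "x s \<le> x t" using ord by (auto simp: x_in \<psi>_def intro!: trapezoid_mono)
      qed
      show "antimono_on {3..4} x"
      proof (rule monotone_onI)
        fix s t :: real assume st: "s \<in> {3..4}" "t \<in> {3..4}" "s \<le> t"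
        hence "s \<in> ?I" "t \<in> ?I" "A s \<le> A t" "A b \<le> A s" using ab pi_gt3 by (auto intro!: le)
        thus "x t \<le> x s" using ord by (auto simp: x_in \<psi>_def intro!: trapezoid_antimono)
      qed
    qed (use ab pi_gt3 x_cont x_left x_right x_mid in
          \<open>auto intro!: continuous_intros integral_sine_kernel_shift\<close>)
    moreover have "(\<Sum>k=1..n. \<epsilon> k / real k) / 2 \<le> cosine_sum \<epsilon> n (c - a)"
      using cd ab by (intro cosine_sum_lower \<epsilon>) auto
    moreover have "cosine_sum \<epsilon> n (d - a) \<le> \<epsilon> 1 / sin (1/2)"
      using cd ab by (intro cosine_sum_upper \<epsilon>) auto
    ultimately have "(\<Sum>k=1..n. \<epsilon> k / real k) / 2 - \<epsilon> 1 / sin (1/2)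
         \<le> integral {0..2*pi} (\<lambda>t. F (h (cis t)) * sine_kernel \<epsilon> n (t - a))"
      by (simp add: x_def)
    moreover have "\<bar>F (cis s) - F (cis t)\<bar> \<le> C * real n * \<bar>s - t\<bar>" for s t
      unfolding F_def by (rule lip[rule_format]) (auto intro: \<psi>lip simp: \<psi>0)
    ultimately show "\<exists>F \<tau>. steep_probe \<epsilon> h C n F \<tau>"
      unfolding steep_probe_def
      using x_cont by (intro exI[of _ F] exI[of _ a]) (auto simp: F_def \<psi>_def trapezoid_bounds x_def)
  qed
qed

section \<open>Scales, signs and the modulus of continuity\<close>

text \<open>
  The scales depend on \<open>\<epsilon>\<close> alone. With amplitudes \<open>a i = 2\<^sup>-\<^sup>i / N i\<close> and slopes \<open>N (i + 1)\<close> the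
  \<open>i\<close>-th pairing is of order at least \<open>i\<close>, while all later terms together are at most
  \<open>1 / N (i + 1)\<close> and so cannot compensate it.
\<close>
lemma exists_scales:
  fixes \<epsilon> :: "nat \<Rightarrow> real"
  assumes pos: "\<And>k. \<epsilon> k \<ge> 0" and div: "\<not> summable (\<lambda>n. \<epsilon> (Suc n) / real (Suc n))"
  obtains N :: "nat \<Rightarrow> nat" where "strict_mono N" "\<And>i. N i \<ge> 1"
    "\<And>i. real i * 2 ^ i * real (N i) \<le> (\<Sum>k=1..N (Suc i). \<epsilon> k / real k)"
proof -
  have S: "(\<Sum>k=1..n. \<epsilon> k / real k) = (\<Sum>k<n. \<epsilon> (Suc k) / real (Suc k))" for n
    by (rule sum.reindex_bij_witness[of _ Suc "\<lambda>k. k - 1"]) auto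
  have unb: "\<exists>n>M. K \<le> (\<Sum>k=1..n. \<epsilon> k / real k)" for K :: real and M :: nat
  proof (rule ccontr)
    assume H: "\<not> ?thesis"
    have "(\<Sum>k<n. norm (\<epsilon> (Suc k) / real (Suc k))) \<le> K" for n
    proof -
      have "(\<Sum>k<n. norm (\<epsilon> (Suc k) / real (Suc k))) = (\<Sum>k<n. \<epsilon> (Suc k) / real (Suc k))"
        using pos by (intro sum.cong) auto
      also have "\<dots> \<le> (\<Sum>k<Suc (n + M). \<epsilon> (Suc k) / real (Suc k))"
        using pos by (intro sum_mono2) auto
      also have "\<dots> = (\<Sum>k=1..Suc (n + M). \<epsilon> k / real k)" by (rule S[symmetric])
      also have "\<dots> \<le> K" using H by (metis le_add2 le_imp_less_Suc linear)
      finally show ?thesis .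
    qed
    hence "(\<Sum>k\<le>n. norm (\<epsilon> (Suc k) / real (Suc k))) \<le> K" for n
      by (simp only: lessThan_Suc_atMost[symmetric])
    hence "summable (\<lambda>n. \<epsilon> (Suc n) / real (Suc n))"
      by (intro summable_norm_cancel[OF bounded_imp_summable]) auto
    thus False using div by simp
  qed
  have "\<exists>N. \<forall>i. N i \<ge> 1 \<and> (N i < N (Suc i) \<and>
      real i * 2 ^ i * real (N i) \<le> (\<Sum>k=1..N (Suc i). \<epsilon> k / real k))"
  proof (rule dependent_nat_choice)
    fix M i :: nat assume "M \<ge> 1"
    obtain n where "n > M" "real i * 2 ^ i * real M \<le> (\<Sum>k=1..n. \<epsilon> k / real k)"
      using unb by blast
    thus "\<exists>n\<ge>1. M < n \<and> real i * 2 ^ i * real M \<le> (\<Sum>k=1..n. \<epsilon> k / real k)"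
      by (intro exI[of _ n]) auto
  qed auto
  then obtain N where "\<And>i. N i \<ge> (1::nat)" "\<And>i. N i < N (Suc i)"
      "\<And>i. real i * 2 ^ i * real (N i) \<le> (\<Sum>k=1..N (Suc i). \<epsilon> k / real k)" by auto
  thus ?thesis using that strict_mono_Suc_iff by blast
qed

text \<open>
  The terms before the \<open>j\<close>-th one are not small in the \<open>j\<close>-th pairing. Giving the new contribution the
  sign of the sum of the earlier ones prevents cancellation.
\<close>
lemma exists_signs:
  fixes b :: "nat \<Rightarrow> nat \<Rightarrow> real"
  obtains s where "\<And>j. s j \<in> {-1, 1::real}" "\<And>j. \<bar>b j j\<bar> \<le> \<bar>\<Sum>i\<le>j. s i * b j i\<bar>"
proof -
  let ?P = "\<lambda>s j r. r \<in> {-1, 1::real} \<and> \<bar>b j j\<bar> \<le> \<bar>(\<Sum>i<j. s i * b j i) + r * b j j\<bar>"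
  have "\<exists>s. \<forall>j. ?P s j (s j)"
  proof (rule dependent_wellorder_choice)
    fix r and s s' :: "nat \<Rightarrow> real" and j assume "\<And>i. i < j \<Longrightarrow> s i = s' i"
    hence "(\<Sum>i<j. s i * b j i) = (\<Sum>i<j. s' i * b j i)" by (intro sum.cong) auto
    thus "?P s j r = ?P s' j r" by simp
  next
    fix j and s :: "nat \<Rightarrow> real"
    define u v where "u = (\<Sum>i<j. s i * b j i)" and "v = b j j"
    have "\<bar>v\<bar> \<le> \<bar>u + 1 * v\<bar> \<or> \<bar>v\<bar> \<le> \<bar>u + (-1) * v\<bar>" by linarith
    thus "\<exists>r. ?P s j r" unfolding u_def v_def by blast
  qed
  then obtain s where s: "\<And>j. ?P s j (s j)" by blast
  show ?thesis
  proof (rule that[of s])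
    show "s j \<in> {-1, 1}" for j using s by blast
    show "\<bar>b j j\<bar> \<le> \<bar>\<Sum>i\<le>j. s i * b j i\<bar>" for j
      using s[of j] by (simp add: lessThan_Suc_atMost[symmetric])
  qed
qed

text \<open>
  A strictly increasing substitute for \<open>min 1 u\<close>. A function with values in \<open>[0, 1]\<close> and Lipschitz
  constant \<open>m\<close> has modulus of continuity at most \<open>min 1 (m \<delta>)\<close>, which is strictly increasing
  only as long as \<open>m \<delta> \<le> 1\<close>.
\<close>
definition saturation :: "real \<Rightarrow> real" where
  "saturation u = u / (1 + u)"

lemma
  assumes "0 \<le> u"
  shows saturation_nonneg: "0 \<le> saturation u" and saturation_le_1: "saturation u \<le> 1"
    and saturation_less: "u < v \<Longrightarrow> saturation u < saturation v"
  using assms by (auto simp: saturation_def field_simps)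

lemma min_le_saturation:
  assumes "0 \<le> u"
  shows "min 1 u \<le> 2 * saturation u"
proof (cases "1 \<le> u")
  case False
  then have "u * u \<le> u * 1" using assms by (intro mult_left_mono) auto
  then show ?thesis using False assms by (simp add: saturation_def field_simps)
qed (simp add: saturation_def field_simps)

lemma modulus_series:
  fixes a m :: "nat \<Rightarrow> real"
  assumes a: "\<And>i. a i > 0" "summable a" and m: "\<And>i. m i > 0"
  defines "\<omega> \<equiv> \<lambda>\<delta>. \<Sum>i. a i * saturation (m i * \<delta>)"
  shows "strict_mono_on {0..} \<omega>" "continuous_on {0..} \<omega>"
    "\<And>\<delta>. 0 \<le> \<delta> \<Longrightarrow> summable (\<lambda>i. a i * saturation (m i * \<delta>))"
proof -
  have bd: "norm (a i * saturation (m i * \<delta>)) \<le> a i" if "\<delta> \<ge> 0" for i \<delta>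
    using a(1)[of i] m[of i] that saturation_nonneg[of "m i * \<delta>"] saturation_le_1[of "m i * \<delta>"]
    by (simp add: abs_mult mult_left_le)
  show sm: "summable (\<lambda>i. a i * saturation (m i * \<delta>))" if "0 \<le> \<delta>" for \<delta>
    by (rule summable_comparison_test'[OF a(2)]) (use bd that in auto)
  show "strict_mono_on {0..} \<omega>"
  proof (rule strict_mono_onI)
    fix s t :: real assume st: "s \<in> {0..}" "t \<in> {0..}" "s < t"
    have "0 < (\<Sum>i. a i * saturation (m i * t) - a i * saturation (m i * s))"
    proof (rule suminf_pos)
      show "0 < a i * saturation (m i * t) - a i * saturation (m i * s)" for i
        using a(1)[of i] m[of i] st by (auto intro!: saturation_less)
    qed (use st in \<open>auto intro!: summable_diff sm\<close>)
    also have "\<dots> = \<omega> t - \<omega> s"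
      unfolding \<omega>_def using st by (subst suminf_diff) (auto intro!: sm)
    finally show "\<omega> s < \<omega> t" by simp
  qed
  show "continuous_on {0..} \<omega>"
    unfolding \<omega>_def
  proof (rule uniform_limit_theorem)
    show "uniform_limit {0..} (\<lambda>n \<delta>. \<Sum>i<n. a i * saturation (m i * \<delta>))
        (\<lambda>\<delta>. \<Sum>i. a i * saturation (m i * \<delta>)) sequentially"
      by (rule Weierstrass_m_test[OF _ a(2)]) (use bd in auto)
    have "1 + m i * \<delta> \<noteq> 0" if "0 \<le> \<delta>" for i \<delta>
      using mult_nonneg_nonneg[of "m i" \<delta>] m[of i] that by linarith
    thus "\<forall>\<^sub>F n in sequentially. continuous_on {0..} (\<lambda>\<delta>. \<Sum>i<n. a i * saturation (m i * \<delta>))"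
      unfolding saturation_def by (intro always_eventually allI continuous_intros) auto
  qed simp
qed

text \<open>
  The series on the right adds up bounds for the moduli of continuity of the terms, and involves
  only their amplitudes and slopes. It can be fixed before a homeomorphism \<open>h\<close> is given, which
  enters through the constant \<open>C\<close>, the signs and the shape of the terms.
\<close>
lemma signed_series_in_H_class:
  fixes a m s :: "nat \<Rightarrow> real" and F :: "nat \<Rightarrow> complex \<Rightarrow> real"
  assumes apos: "\<And>i. a i > 0" and asum: "summable a" and m: "\<And>i. m i > 0" and C: "C \<ge> 1"
    and abs_s: "\<And>i. \<bar>s i\<bar> = 1" and F: "\<And>i z. 0 \<le> F i z" "\<And>i z. F i z \<le> 1"
    and Flip: "\<And>i x y. \<bar>F i (cis x) - F i (cis y)\<bar> \<le> C * m i * \<bar>x - y\<bar>"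
  shows "(\<lambda>z. \<Sum>i. s i * a i * F i z) \<in> H_class (\<lambda>\<delta>. \<Sum>i. a i * saturation (m i * \<delta>))"
proof -
  define f where "f = (\<lambda>z. \<Sum>i. s i * a i * F i z)"
  define \<omega> where "\<omega> = (\<lambda>\<delta>. \<Sum>i. a i * saturation (m i * \<delta>))"
  note \<omega> = modulus_series[of a m, OF apos asum m, folded \<omega>_def]
  have F_term: "norm (s i * a i * F i z) \<le> a i" for i z
    using abs_s[of i] apos[of i] F[of i z] by (simp add: abs_mult mult_left_le)
  have fsum: "summable (\<lambda>i. s i * a i * F i z)" for z
    by (rule summable_comparison_test'[OF asum]) (use F_term in auto)
  have Fmod: "\<bar>F i (cis x) - F i (cis y)\<bar> \<le> 2 * C * saturation (m i * \<bar>x - y\<bar>)" for i x y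
  proof -
    define u where "u = m i * \<bar>x - y\<bar>"
    have "\<bar>F i (cis x) - F i (cis y)\<bar> \<le> C * 1"
      using F(1)[of i "cis x"] F(2)[of i "cis x"] F(1)[of i "cis y"] F(2)[of i "cis y"] C
      by linarith
    moreover have "\<bar>F i (cis x) - F i (cis y)\<bar> \<le> C * u" using Flip[of i x y] by (simp add: u_def)
    ultimately have "\<bar>F i (cis x) - F i (cis y)\<bar> \<le> C * min 1 u" by (simp add: min_def)
    also have "\<dots> \<le> C * (2 * saturation u)"
      using C by (intro mult_left_mono min_le_saturation) (auto simp: u_def intro!: mult_nonneg_nonneg less_imp_le[OF m])
    finally show ?thesis by (simp add: u_def)
  qed
  have fmod: "\<bar>f (cis x) - f (cis y)\<bar> \<le> 2 * C * \<omega> \<bar>x - y\<bar>" for x y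
  proof -
    have "f (cis x) - f (cis y) = (\<Sum>i. s i * a i * F i (cis x) - s i * a i * F i (cis y))"
      unfolding f_def by (rule suminf_diff[OF fsum fsum])
    also have "norm \<dots> \<le> (\<Sum>i. 2 * C * (a i * saturation (m i * \<bar>x - y\<bar>)))"
    proof (rule norm_suminf_le)
      fix i
      have "norm (s i * a i * F i (cis x) - s i * a i * F i (cis y))
          = a i * \<bar>F i (cis x) - F i (cis y)\<bar>"
        using abs_s[of i] apos[of i] by (simp flip: right_diff_distrib add: abs_mult)
      also have "\<dots> \<le> a i * (2 * C * saturation (m i * \<bar>x - y\<bar>))"
        using apos[of i] by (intro mult_left_mono Fmod) auto
      finally show "norm (s i * a i * F i (cis x) - s i * a i * F i (cis y))
          \<le> 2 * C * (a i * saturation (m i * \<bar>x - y\<bar>))" by (simp add: algebra_simps)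
    qed (intro summable_mult \<omega>(3), simp)
    also have "\<dots> = 2 * C * \<omega> \<bar>x - y\<bar>"
      unfolding \<omega>_def by (rule suminf_mult) (intro \<omega>(3), simp)
    finally show ?thesis by simp
  qed
  have "f \<in> H_class \<omega>"
    unfolding H_class_def mem_Collect_eq
  proof (intro exI[of _ "2 * C"] eventually_at_rightI[of 0 1])
    fix \<delta> :: real assume \<delta>: "\<delta> \<in> {0<..<1}"
    show "modulus_of_continuity f \<delta> \<le> ereal (2 * C * \<omega> \<delta>)"
      unfolding modulus_of_continuity_def
    proof (rule SUP_least)
      fix p assume "p \<in> {(s, t). \<bar>s - t\<bar> < \<delta>}"
      then obtain x y where p: "p = (x, y)" "\<bar>x - y\<bar> < \<delta>" by auto
      have "\<omega> \<bar>x - y\<bar> \<le> \<omega> \<delta>"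
        using \<omega>(1) p(2) \<delta> by (intro less_imp_le) (auto simp: monotone_on_def)
      hence "2 * C * \<omega> \<bar>x - y\<bar> \<le> 2 * C * \<omega> \<delta>" using C by (intro mult_left_mono) auto
      with fmod[of x y] p(1) show
        "(case p of (s, t) \<Rightarrow> ereal \<bar>f (cis s) - f (cis t)\<bar>) \<le> ereal (2 * C * \<omega> \<delta>)"
        by simp
    qed
  qed simp
  thus ?thesis by (simp add: f_def \<omega>_def)
qed

section \<open>The superposition\<close>

lemma integral_product_diff_bound:
  fixes X P :: "real \<Rightarrow> real"
  assumes "a \<le> b" and cont: "continuous_on {a..b} X" "continuous_on {a..b} P" "continuous_on {a..b} D"
    and XP: "\<And>t. t \<in> {a..b} \<Longrightarrow> \<bar>X t - P t\<bar> \<le> c" and D: "\<And>t. t \<in> {a..b} \<Longrightarrow> \<bar>D t\<bar> \<le> d"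
  shows "\<bar>integral {a..b} (\<lambda>t. X t * D t) - integral {a..b} (\<lambda>t. P t * D t)\<bar> \<le> c * d * (b - a)"
proof -
  have "integral {a..b} (\<lambda>t. X t * D t) - integral {a..b} (\<lambda>t. P t * D t)
      = integral {a..b} (\<lambda>t. (X t - P t) * D t)"
    unfolding left_diff_distrib
    by (rule Henstock_Kurzweil_Integration.integral_diff[symmetric])
       (auto intro!: integrable_continuous_real continuous_intros cont)
  also have "norm \<dots> \<le> c * d * (b - a)"
  proof (rule integral_bound)
    have "c \<ge> 0" using XP[of a] assms(1) by auto
    thus "norm ((X t - P t) * D t) \<le> c * d" if "t \<in> {a..b}" for t
      using XP[OF that] D[OF that] by (simp add: abs_mult mult_mono)
  qed (use assms in \<open>auto intro!: continuous_intros\<close>)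
  finally show ?thesis by simp
qed

theorem theorem3:
  fixes \<epsilon> :: "nat \<Rightarrow> real"
  assumes "\<And>n. \<epsilon> n > 0"
    and "\<epsilon> \<longlonglongrightarrow> 0"
    and "regular_seq \<epsilon>"
    and "\<not> summable (\<lambda>n. \<epsilon> (Suc n) / real (Suc n))"
  shows "\<exists>\<omega> :: real \<Rightarrow> real.
           strict_mono_on {0..} \<omega> \<and> continuous_on {0..} \<omega> \<and> \<omega> 0 = 0 \<and>
           (\<forall>h. (\<exists>g. homeomorphism circle circle h g) \<longrightarrow>
             (\<exists>f \<in> H_class \<omega>. (\<lambda>z. complex_of_real (f (h z))) \<notin> A_space \<epsilon>))"
proof -
  have dec: "decseq \<epsilon>" using assms(3) by (simp add: regular_seq_def)
  have nonneg: "\<epsilon> k \<ge> 0" for k using assms(1)[of k] by simp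
  obtain N where N: "strict_mono N" "\<And>i. N i \<ge> 1"
    "\<And>i. real i * 2 ^ i * real (N i) \<le> (\<Sum>k=1..N (Suc i). \<epsilon> k / real k)"
    using exists_scales[OF nonneg assms(4)] by blast
  define m where "m = (\<lambda>i. N (Suc i))"
  define a where "a = (\<lambda>i. (1/2::real) ^ i / real (N i))"
  define \<omega> where "\<omega> = (\<lambda>\<delta>. \<Sum>i. a i * saturation (real (m i) * \<delta>))"
  have Npos: "real (N i) > 0" for i using N(2)[of i] by simp
  have mpos: "real (m i) > 0" and m1: "m i \<ge> 1" for i using N(2)[of "Suc i"] by (auto simp: m_def)
  have apos: "a i > 0" for i using Npos[of i] by (simp add: a_def)
  have a_tail: "a (i + Suc j) \<le> (1/2) ^ Suc i / real (m j)" for i j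
  proof -
    have "N (Suc j) \<le> N (i + Suc j)" by (rule monoD[OF strict_mono_mono[OF N(1)]]) simp
    moreover have "(1/2::real) ^ (i + Suc j) \<le> (1/2) ^ Suc i" by (rule power_decreasing) auto
    ultimately show ?thesis unfolding a_def m_def using Npos by (intro frac_le) auto
  qed
  have asum: "summable a"
  proof (rule summable_comparison_test'[of "\<lambda>i. (1/2::real) ^ i"])
    show "norm (a i) \<le> (1/2) ^ i" for i
      using N(2)[of i] by (simp add: a_def field_simps)
  qed auto
  note \<omega> = modulus_series[of a "\<lambda>i. real (m i)", OF apos asum mpos, folded \<omega>_def]
  have "\<exists>f \<in> H_class \<omega>. (\<lambda>z. complex_of_real (f (h z))) \<notin> A_space \<epsilon>"
    if hom: "homeomorphism circle circle h g" for h g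
  proof -
    obtain C where C: "C \<ge> 1" "\<And>n. n \<ge> 1 \<Longrightarrow> \<exists>F \<tau>. steep_probe \<epsilon> h C n F \<tau>"
      using exists_steep_probe[OF hom dec nonneg] by blast
    have "\<forall>i. \<exists>F \<tau>. steep_probe \<epsilon> h C (m i) F \<tau>" using C(2) m1 by blast
    then obtain F \<tau> where "\<And>i. steep_probe \<epsilon> h C (m i) (F i) (\<tau> i)" unfolding choice_iff by blast
    hence F: "\<And>i z. 0 \<le> F i z" "\<And>i z. F i z \<le> 1"
      and Flip: "\<And>i s t. \<bar>F i (cis s) - F i (cis t)\<bar> \<le> C * real (m i) * \<bar>s - t\<bar>"
      and Fcont: "\<And>i. continuous_on {0..2*pi} (\<lambda>t. F i (h (cis t)))"
      and Flow: "\<And>i. (\<Sum>k=1..m i. \<epsilon> k / real k) / 2 - \<epsilon> 1 / sin (1/2)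
         \<le> integral {0..2*pi} (\<lambda>t. F i (h (cis t)) * sine_kernel \<epsilon> (m i) (t - \<tau> i))"
      unfolding steep_probe_def by blast+
    define D where "D = (\<lambda>j t. sine_kernel \<epsilon> (m j) (t - \<tau> j))"
    \<comment> \<open>The pairing of the \<open>i\<close>-th term with the \<open>j\<close>-th kernel.\<close>
    define b where "b = (\<lambda>j i. a i * integral {0..2*pi} (\<lambda>t. F i (h (cis t)) * D j t))"
    obtain s where s: "\<And>j. s j \<in> {-1, 1::real}" "\<And>j. \<bar>b j j\<bar> \<le> \<bar>\<Sum>i\<le>j. s i * b j i\<bar>"
      using exists_signs[of b] by metis
    have abs_s: "\<bar>s i\<bar> = 1" for i using s(1)[of i] by auto
    define f where "f = (\<lambda>z. \<Sum>i. s i * a i * F i z)"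
    have F_term: "norm (s i * a i * F i z) \<le> a i" for i z
      using abs_s[of i] apos[of i] F[of i z] by (simp add: abs_mult mult_left_le)
    have fsum: "summable (\<lambda>i. s i * a i * F i z)" for z
      by (rule summable_comparison_test'[OF asum]) (use F_term in auto)
    have "f \<in> H_class \<omega>"
      unfolding f_def \<omega>_def
      by (rule signed_series_in_H_class[OF apos asum mpos C(1)]) (use F Flip abs_s in auto)
    moreover have "(\<lambda>z. complex_of_real (f (h z))) \<notin> A_space \<epsilon>"
    proof
      assume A: "(\<lambda>z. complex_of_real (f (h z))) \<in> A_space \<epsilon>"
      define W where "W = 2 * pi * (\<Sum>\<^sub>\<infinity>k::int. norm (fourier_coeff (\<lambda>z. complex_of_real (f (h z))) k) * \<epsilon> (nat \<bar>k\<bar>))"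
      define B where "B = \<epsilon> 1 / sin (1/2)"
      have "sin (1/2) > (0::real)" using pi_gt3 by (intro sin_gt_zero) auto
      hence B: "B \<ge> 0" using nonneg by (simp add: B_def)
      have fcont: "continuous_on {0..2*pi} (\<lambda>t. f (h (cis t)))"
        unfolding f_def
      proof (rule uniform_limit_theorem)
        show "uniform_limit {0..2*pi} (\<lambda>n t. \<Sum>i<n. s i * a i * F i (h (cis t)))
            (\<lambda>t. \<Sum>i. s i * a i * F i (h (cis t))) sequentially"
          by (rule Weierstrass_m_test[OF _ asum]) (use F_term in auto)
        show "\<forall>\<^sub>F n in sequentially. continuous_on {0..2*pi} (\<lambda>t. \<Sum>i<n. s i * a i * F i (h (cis t)))"
          by (intro always_eventually allI continuous_intros Fcont)
      qed simp
      \<comment> \<open>The \<open>j\<close>-th pairing is bounded by \<open>2\<pi>\<close> times the norm, yet grows like \<open>j / 2\<close> up to constants.\<close>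
      have "real j / 2 \<le> W + B + 2 * pi * \<epsilon> 0" for j
      proof -
        let ?P = "\<lambda>t. \<Sum>i\<le>j. s i * a i * F i (h (cis t))"
        have Dcont: "continuous_on {0..2*pi} (D j)"
          unfolding D_def by (intro continuous_intros)
        have "\<bar>integral {0..2*pi} (\<lambda>t. f (h (cis t)) * D j t)\<bar> \<le> W"
          unfolding W_def D_def using fcont A nonneg by (rule kernel_integral_le_A_norm)
        moreover have "\<bar>integral {0..2*pi} (\<lambda>t. f (h (cis t)) * D j t) - integral {0..2*pi} (\<lambda>t. ?P t * D j t)\<bar>
            \<le> 1 / real (m j) * (real (m j) * \<epsilon> 0) * (2 * pi - 0)"
        proof (rule integral_product_diff_bound[OF _ fcont _ Dcont])
          show "continuous_on {0..2*pi} ?P" by (intro continuous_intros Fcont)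
          show "\<bar>D j t\<bar> \<le> real (m j) * \<epsilon> 0" for t
            unfolding D_def by (rule abs_sine_kernel_le[OF dec nonneg])
          show "\<bar>f (h (cis t)) - ?P t\<bar> \<le> 1 / real (m j)" for t
          proof -
            have "f (h (cis t)) - ?P t = (\<Sum>i. s (i + Suc j) * a (i + Suc j) * F (i + Suc j) (h (cis t)))"
              unfolding f_def using suminf_minus_initial_segment[OF fsum, of "Suc j"]
              by (simp add: lessThan_Suc_atMost)
            also have "norm \<dots> \<le> (\<Sum>i. (1/2) ^ Suc i / real (m j))"
            proof (rule norm_suminf_le)
              show "norm (s (i + Suc j) * a (i + Suc j) * F (i + Suc j) (h (cis t)))
                  \<le> (1/2) ^ Suc i / real (m j)" for i
                using F_term[of "i + Suc j" "h (cis t)"] a_tail[of i j] by linarith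
              show "summable (\<lambda>i. (1/2::real) ^ Suc i / real (m j))"
                by (intro summable_divide sums_summable[OF power_half_series])
            qed
            also have "\<dots> = 1 / real (m j)"
              by (subst suminf_divide) (auto intro!: sums_summable[OF power_half_series] simp only: sums_unique[OF power_half_series, symmetric])
            finally show ?thesis by simp
          qed
        qed simp
        moreover have "integral {0..2*pi} (\<lambda>t. ?P t * D j t) = (\<Sum>i\<le>j. s i * b j i)"
        proof -
          have "integral {0..2*pi} (\<lambda>t. ?P t * D j t)
              = integral {0..2*pi} (\<lambda>t. \<Sum>i\<le>j. s i * a i * (F i (h (cis t)) * D j t))"
            by (simp add: sum_distrib_right mult.assoc)
          also have "\<dots> = (\<Sum>i\<le>j. s i * a i * integral {0..2*pi} (\<lambda>t. F i (h (cis t)) * D j t))"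
            by (subst integral_sum)
               (auto intro!: integrable_continuous_real continuous_intros Fcont Dcont)
          finally show ?thesis by (simp add: b_def mult.assoc)
        qed
        moreover have "real j / 2 - B \<le> b j j"
        proof -
          have "real j \<le> a j * (\<Sum>k=1..m j. \<epsilon> k / real k)"
          proof -
            have "real j = a j * (real j * 2 ^ j * real (N j))"
              using Npos[of j] by (simp add: a_def power_one_over field_simps)
            also have "\<dots> \<le> a j * (\<Sum>k=1..m j. \<epsilon> k / real k)"
              unfolding m_def using apos[of j] N(3)[of j] by (intro mult_left_mono) auto
            finally show ?thesis .
          qed
          moreover have "a j * B \<le> 1 * B"
          proof (rule mult_right_mono[OF _ B])
            have "(1/2::real) ^ j \<le> 1" by (simp add: power_le_one)
            thus "a j \<le> 1" using N(2)[of j] by (simp add: a_def divide_le_eq)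
          qed
          moreover have "a j * ((\<Sum>k=1..m j. \<epsilon> k / real k) / 2 - B) \<le> b j j"
            unfolding b_def D_def B_def using apos[of j] by (intro mult_left_mono Flow) auto
          ultimately show ?thesis by (simp add: algebra_simps)
        qed
        moreover have "1 / real (m j) * (real (m j) * \<epsilon> 0) * (2 * pi - 0) = 2 * pi * \<epsilon> 0"
          using mpos[of j] by simp
        ultimately show ?thesis using s(2)[of j] by linarith
      qed
      moreover obtain j :: nat where "real j > 2 * (W + B + 2 * pi * \<epsilon> 0)"
        using reals_Archimedean2 by blast
      ultimately show False by (smt (verit) field_sum_of_halves)
    qed
    ultimately show ?thesis by blast
  qed
  moreover have "\<omega> 0 = 0" by (simp add: \<omega>_def saturation_def)
  ultimately show ?thesis using \<omega>(1,2) by blast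
qed

end
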